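(* Let $G$ be a graph with $\chi_{st}(G)=k$. Then $\chi'_{\mathrm{inj}}(G)\leq \frac{k(k-1)}{2}$.
   Context: All graphs are finite and simple. A star coloring of $G$ is a proper vertex coloring of $G$ such that the union of any two color classes induces a star forest in $G$, i.e. every component of the induced subgraph is a star. The star chromatic number $\chi_{st}(G)$ is the smallest integer $k$ for which $G$ admits a star coloring with $k$ colors. Three edges $e_1,e_2,e_3$ of a graph are consecutive if they form (in this order) a path of length three or a cycle of length three. An injective edge-coloring of $G$ with $k$ colors is a map $c:E(G)\to\{1,\dots,k\}$ (not necessarily a proper edge-coloring) such that $c(e_1)\neq c(e_3)$ whenever $e_1,e_2,e_3$ are consecutive edges in $G$. The injective chromatic index $\chi'_{\mathrm{inj}}(G)$ is the minimum $k$ such that $G$ has an injective edge-coloring with $k$ colors. *)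

theory Defs
  imports "Graph_Theory.Graph_Theory"
begin

text \<open>
  Following \<^theory>\<open>Graph_Theory.Digraph\<close>, a finite simple graph is a symmetric digraph
  without loops and parallel arcs (locale \<^locale>\<open>graph\<close>).  An undirected edge is thus represented
  by two opposite arcs; \<open>edges\<close> recovers the undirected edges as two-element vertex sets.
\<close>

definition edges :: "('a, 'b) pre_digraph \<Rightarrow> 'a set set" where
  "edges G = {{u, v} | u v. u \<rightarrow>\<^bsub>G\<^esub> v}"

text \<open>The case \<open>n = 0\<close>, a single vertex, counts as a star.\<close>

definition star :: "('a, 'b) pre_digraph \<Rightarrow> bool" where
  "star H \<longleftrightarrow> (\<exists>n. complete_bipartite_digraph 1 n H)"

definition component :: "('a, 'b) pre_digraph \<Rightarrow> ('a, 'b) pre_digraph \<Rightarrow> bool" where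
  "component C H \<longleftrightarrow> pre_digraph.max_subgraph H connected C"

definition star_forest :: "('a, 'b) pre_digraph \<Rightarrow> bool" where
  "star_forest H \<longleftrightarrow> (\<forall>C. component C H \<longrightarrow> star C)"

definition proper_coloring :: "('a, 'b) pre_digraph \<Rightarrow> nat \<Rightarrow> ('a \<Rightarrow> nat) \<Rightarrow> bool" where
  "proper_coloring G k c \<longleftrightarrow>
     c ` verts G \<subseteq> {1..k} \<and> (\<forall>u v. u \<rightarrow>\<^bsub>G\<^esub> v \<longrightarrow> c u \<noteq> c v)"

definition color_class :: "('a, 'b) pre_digraph \<Rightarrow> ('a \<Rightarrow> nat) \<Rightarrow> nat \<Rightarrow> 'a set" where
  "color_class G c i = {v \<in> verts G. c v = i}"

definition star_coloring :: "('a, 'b) pre_digraph \<Rightarrow> nat \<Rightarrow> ('a \<Rightarrow> nat) \<Rightarrow> bool" where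
  "star_coloring G k c \<longleftrightarrow> proper_coloring G k c \<and>
     (\<forall>i\<in>{1..k}. \<forall>j\<in>{1..k}. i \<noteq> j \<longrightarrow>
        star_forest (G \<restriction> (color_class G c i \<union> color_class G c j)))"

text \<open>
  For a finite simple graph, the minima below are attained: colorings that are injective on
  the vertices (respectively on the edges) are star colorings (injective edge-colorings).
\<close>

definition star_chromatic_number :: "('a, 'b) pre_digraph \<Rightarrow> nat" where
  "star_chromatic_number G = (LEAST k. \<exists>c. star_coloring G k c)"

text \<open>First disjunct: a path of length three; second disjunct: a cycle of length three.\<close>

definition consecutive :: "('a, 'b) pre_digraph \<Rightarrow> 'a set \<Rightarrow> 'a set \<Rightarrow> 'a set \<Rightarrow> bool" where
  "consecutive G e1 e2 e3 \<longleftrightarrow> e1 \<in> edges G \<and> e2 \<in> edges G \<and> e3 \<in> edges G \<and>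
     ((\<exists>u v w x. distinct [u, v, w, x] \<and> e1 = {u, v} \<and> e2 = {v, w} \<and> e3 = {w, x}) \<or>
      (\<exists>u v w. distinct [u, v, w] \<and> e1 = {u, v} \<and> e2 = {v, w} \<and> e3 = {w, u}))"

definition injective_edge_coloring :: "('a, 'b) pre_digraph \<Rightarrow> nat \<Rightarrow> ('a set \<Rightarrow> nat) \<Rightarrow> bool" where
  "injective_edge_coloring G k c \<longleftrightarrow> c ` edges G \<subseteq> {1..k} \<and>
     (\<forall>e1 e2 e3. consecutive G e1 e2 e3 \<longrightarrow> c e1 \<noteq> c e3)"

definition injective_chromatic_index :: "('a, 'b) pre_digraph \<Rightarrow> nat" where
  "injective_chromatic_index G = (LEAST k. \<exists>c. injective_edge_coloring G k c)"

end

theory Submission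
  imports Defs
begin

text \<open>
  Given a star coloring, color every edge by the unordered pair of colors of its ends; this uses
  at most \<open>k choose 2\<close> colors.  If the outer edges of a path \<open>u v w x\<close> have the same pair, then
  properness at the middle edge forces the pattern \<open>i j i j\<close> along the path, so that two color
  classes contain a path on four vertices, which no star does.  For a triangle, equal pairs
  already contradict properness.
\<close>

section \<open>Components of symmetric digraphs as strongly connected components\<close>

lemma graph_induce_subgraph:
  assumes "graph G" "S \<subseteq> verts G"
  shows "graph (G \<restriction> S)"
proof -
  interpret graph G by fact
  have ind: "induced_subgraph (G \<restriction> S) G"
    using assms(2) by blast
  interpret H: digraph "G \<restriction> S"
    using ind by (rule digraphI_induced)
  show ?thesis
    using induced_graph_imp_symmetric[OF sym_arcs ind] by (rule H.graphI)
qed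

lemma (in wf_digraph) strongly_connected_imp_connected:
  assumes "strongly_connected G"
  shows "connected G"
  using assms
  by (auto intro!: connectedI reachable_mk_symmetricI simp: strongly_connected_def)

text \<open>Gives access to the theory of \<open>sccs\<close>. A subgraph may contain only one of
  two opposite arcs, so connected subgraphs need not be strongly connected; the two maximality
  notions are compared through induced subgraphs, which inherit symmetry from
  \<open>G\<close>.\<close>

lemma (in sym_digraph) component_iff_sccs: "component C G \<longleftrightarrow> C \<in> sccs"
proof
  have conn: "strongly_connected H \<Longrightarrow> subgraph H G \<Longrightarrow> connected H" for H
    by (auto simp: subgraph_def intro: wf_digraph.strongly_connected_imp_connected)
  have conn_induce: "connected (G \<restriction> verts H)" "strongly_connected (G \<restriction> verts H)"
    if "connected H" "subgraph H G" for H
  proof -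
    interpret K: wf_digraph "G \<restriction> verts H" by blast
    have sub: "subgraph H (G \<restriction> verts H)"
      using that by (rule_tac subgraph_induce_subgraphI2)
    then show "connected (G \<restriction> verts H)"
      using that by (intro K.connected_spanning_imp_connected) (auto simp: spanning_def)
    moreover have "symmetric (G \<restriction> verts H)"
      using that by (intro induced_graph_imp_symmetric[OF sym_arcs] induced_induce) auto
    ultimately show "strongly_connected (G \<restriction> verts H)"
      by (intro K.symmetric_connected_imp_strongly_connected)
  qed
  \<comment> \<open>Stated for arbitrary \<open>P\<close> because it serves both directions: with
    \<open>connected\<close> and \<open>H = C\<close> in the first, with
    \<open>strongly_connected\<close> and a larger connected \<open>H\<close> in the second.\<close>
  have max_eq: "C = G \<restriction> verts H"
    if "max_subgraph P C" "subgraph C H" "subgraph H G" "P (G \<restriction> verts H)" for C H P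
  proof -
    have "subgraph (G \<restriction> verts H) G"
      using that by (intro subgraph_induce_subgraphI) auto
    moreover have "subgraph C (G \<restriction> verts H)"
      using that subgraph_induce_subgraphI2 subgraph_trans by metis
    ultimately show ?thesis
      using that by (metis max_subgraph_def)
  qed
  show "C \<in> sccs" if "component C G"
  proof -
    have m: "max_subgraph connected C"
      using that by (simp add: component_def)
    then have C: "connected C" "subgraph C G"
      by (auto simp: max_subgraph_def)
    then have "C = G \<restriction> verts C"
      using m conn_induce(1) max_eq wf_digraph.subgraph_refl subgraphE by metis
    then have sc: "strongly_connected C"
      using conn_induce(2) C by metis
    have "max_subgraph strongly_connected C"
    proof (rule max_subgraphI)
      fix y assume "C \<noteq> y" "subgraph C y" "subgraph y G"
      then show "\<not> strongly_connected y"
        using m conn[of y] unfolding max_subgraph_def by metis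
    qed (use sc C in auto)
    then show ?thesis by (simp add: sccs_altdef2)
  qed
  show "component C G" if "C \<in> sccs"
  proof -
    have m: "max_subgraph strongly_connected C"
      using that by (simp add: sccs_altdef2)
    then have C: "strongly_connected C" "subgraph C G"
      by (auto simp: max_subgraph_def)
    have "max_subgraph connected C"
    proof (rule max_subgraphI)
      fix y assume y: "C \<noteq> y" "subgraph C y" "subgraph y G"
      show "\<not> connected y"
      proof
        assume "connected y"
        then have "C = G \<restriction> verts y"
          using m y conn_induce(2) max_eq by blast
        moreover have "subgraph y (G \<restriction> verts y)"
          using y by (rule_tac subgraph_induce_subgraphI2)
        \<comment> \<open>\<open>y\<close> is squeezed between \<open>C\<close> and
          \<open>G \<restriction> verts y\<close>, which are equal.\<close>
        ultimately have "C = y"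
          using y(2) by (intro pre_digraph.equality) (auto simp: subgraph_def compatible_def)
        with y show False by simp
      qed
    qed (use conn C in auto)
    then show ?thesis by (simp add: component_def)
  qed
qed

section \<open>Excluding paths on four vertices\<close>

text \<open>The walk alternates between the two sides, so the one-element side contains both
  \<open>u\<close> and \<open>w\<close> or both \<open>v\<close> and \<open>x\<close>.\<close>

lemma star_no_P4:
  assumes "star H" "u \<rightarrow>\<^bsub>H\<^esub> v" "v \<rightarrow>\<^bsub>H\<^esub> w" "w \<rightarrow>\<^bsub>H\<^esub> x"
  shows "u = w \<or> v = x"
proof -
  obtain U V where "card U = 1" "U \<inter> V = {}" "arcs_ends H = U \<times> V \<union> V \<times> U"
    using assms(1) by (auto simp: star_def complete_bipartite_digraph_def)
  then show ?thesis
    using assms(2-4) by (auto simp: card_1_singleton_iff)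
qed

lemma star_forest_no_P4:
  assumes "graph H" "star_forest H" "u \<rightarrow>\<^bsub>H\<^esub> v" "v \<rightarrow>\<^bsub>H\<^esub> w" "w \<rightarrow>\<^bsub>H\<^esub> x"
  shows "u = w \<or> v = x"
proof -
  interpret graph H by fact
  \<comment> \<open>The component of \<open>u\<close>: the whole walk is reachable from
    \<open>u\<close>, hence survives in \<open>?C\<close>.\<close>
  let ?C = "H \<restriction> {y. u \<rightarrow>\<^sup>*\<^bsub>H\<^esub> y}"
  have "u \<in> verts H"
    using assms(3) by (rule adj_in_verts)
  then have "star ?C"
    using assms(2) induce_reachable_is_in_sccs component_iff_sccs by (simp add: star_forest_def)
  moreover have "y \<rightarrow>\<^bsub>?C\<^esub> z" if "u \<rightarrow>\<^sup>*\<^bsub>H\<^esub> y" "y \<rightarrow>\<^bsub>H\<^esub> z" for y z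
    using that reachable_adj_trans[OF that] by (force simp: arcs_ends_conv)
  ultimately show ?thesis
    using assms(3-5) \<open>u \<in> verts H\<close>
    by (meson star_no_P4 reachable_refl reachable_adj_trans)
qed

section \<open>Existence of star colorings\<close>

lemma star_forest_card_le_2:
  assumes "graph H" "card (verts H) \<le> 2"
  shows "star_forest H"
  unfolding star_forest_def
proof (intro allI impI)
  interpret graph H by fact
  fix C assume "component C H"
  then have "C \<in> sccs" by (simp add: component_iff_sccs)
  then have ind: "induced_subgraph C H" and sc: "strongly_connected C"
    by (auto simp: sccs_def)
  have sub: "verts C \<subseteq> verts H"
    using ind by (auto simp: induced_subgraph_def subgraph_def)
  then have "graph (H \<restriction> verts C)"
    using assms(1) graph_induce_subgraph by blast
  then interpret C: graph C
    using induce_eq_iff_induced[OF ind] by simp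
  \<comment> \<open>Any vertex can be the centre: the remaining set has at most one element, and if
    it is empty, \<open>C\<close> is the star with \<open>n = 0\<close>.\<close>
  obtain a where a: "a \<in> verts C"
    using sc by (auto simp: strongly_connected_def)
  have "card (verts C) \<le> 2"
    using sub assms(2) card_mono[OF finite_verts] by (meson le_trans)
  then have two: "x = y" if "x \<in> verts C - {a}" "y \<in> verts C - {a}" for x y
    using that a card_mono[of "verts C" "{a, x, y}"] by (auto simp: card_insert_if split: if_splits)
  have adj: "a \<rightarrow>\<^bsub>C\<^esub> x" if x: "x \<in> verts C - {a}" for x
  proof -
    have "a \<rightarrow>\<^sup>*\<^bsub>C\<^esub> x"
      using sc a x by (auto simp: strongly_connected_def)
    \<comment> \<open>The first arc of a walk from \<open>a\<close> to \<open>x\<close> leaves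
      \<open>a\<close>, and \<open>x\<close> is the only vertex it can lead to.\<close>
    then obtain w where w: "a \<rightarrow>\<^bsub>C\<^esub> w"
      using x by (cases rule: C.converse_reachable_cases) auto
    then have "w \<in> verts C - {a}"
      using C.adj_in_verts C.adj_not_same by blast
    with w x two show ?thesis by blast
  qed
  have "arcs_ends C = {a} \<times> (verts C - {a}) \<union> (verts C - {a}) \<times> {a}"
  proof (intro set_eqI iffI)
    fix p assume p: "p \<in> arcs_ends C"
    obtain x y where xy: "p = (x, y)" by fastforce
    with p have "x \<in> verts C" "y \<in> verts C" "x \<noteq> y"
      using C.adj_in_verts C.adj_not_same by blast+
    then show "p \<in> {a} \<times> (verts C - {a}) \<union> (verts C - {a}) \<times> {a}"
      using two xy by blast
  next
    fix p assume "p \<in> {a} \<times> (verts C - {a}) \<union> (verts C - {a}) \<times> {a}"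
    then show "p \<in> arcs_ends C"
      using adj arcs_ends_symmetric[OF C.sym_arcs] by blast
  qed
  moreover have "verts C = {a} \<union> (verts C - {a})" "{a} \<inter> (verts C - {a}) = {}" "card {a} = 1"
    using a by auto
  ultimately show "star C"
    unfolding star_def complete_bipartite_digraph_def using C.graph_axioms by blast
qed

text \<open>Ensures that the \<open>LEAST\<close> in \<open>star_chromatic_number\<close> is
  attained. If all vertices get different colors, two color classes span at most two
  vertices.\<close>

lemma star_coloring_exists:
  assumes "graph G"
  shows "\<exists>k c. star_coloring G k c"
proof -
  interpret graph G by fact
  obtain c where c: "bij_betw c (verts G) {1..card (verts G)}"
    by (metis bij_betw_iff_card card_atLeastAtMost diff_Suc_1 finite_atLeastAtMost finite_verts)
  let ?S = "\<lambda>i j. color_class G c i \<union> color_class G c j"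
  have cls: "card (color_class G c i) \<le> 1" for i
  proof -
    have "x = y" if "x \<in> color_class G c i" "y \<in> color_class G c i" for x y
      using that c by (auto simp: color_class_def bij_betw_def inj_on_def)
    then show ?thesis
      \<comment> \<open>\<open>card.infinite\<close> settles the infinite case by the default value
        0.\<close>
      by (metis One_nat_def card_le_Suc0_iff_eq card.infinite le_SucI le0)
  qed
  have "star_forest (G \<restriction> ?S i j)" for i j
  proof (rule star_forest_card_le_2)
    show "graph (G \<restriction> ?S i j)"
      by (rule graph_induce_subgraph[OF assms]) (auto simp: color_class_def)
    show "card (verts (G \<restriction> ?S i j)) \<le> 2"
      using cls[of i] cls[of j] card_Un_le[of "color_class G c i" "color_class G c j"] by simp
  qed
  moreover have "proper_coloring G (card (verts G)) c"
    unfolding proper_coloring_def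
  proof (intro conjI allI impI)
    show "c ` verts G \<subseteq> {1..card (verts G)}"
      using c by (simp add: bij_betw_def)
    fix u v assume "u \<rightarrow>\<^bsub>G\<^esub> v"
    then have "u \<in> verts G" "v \<in> verts G" "u \<noteq> v"
      using adj_in_verts adj_not_same by blast+
    then show "c u \<noteq> c v"
      using c by (auto simp: bij_betw_def inj_on_def)
  qed
  ultimately show ?thesis
    unfolding star_coloring_def by blast
qed

section \<open>From star colorings to injective edge-colorings\<close>

lemma (in graph) edges_iff_adj: "{u, v} \<in> edges G \<longleftrightarrow> u \<rightarrow>\<^bsub>G\<^esub> v"
  using arcs_ends_symmetric[OF sym_arcs] by (auto simp: edges_def doubleton_eq_iff)

lemma star_coloring_image_neq:
  assumes "graph G" "star_coloring G k c" "consecutive G e1 e2 e3"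
  shows "c ` e1 \<noteq> c ` e3"
proof
  interpret graph G by fact
  assume eq: "c ` e1 = c ` e3"
  have neq: "c u \<noteq> c v" "c u \<in> {1..k}" "c v \<in> {1..k}" if "u \<rightarrow>\<^bsub>G\<^esub> v" for u v
    using assms(2) that adj_in_verts[OF that]
    by (auto simp: star_coloring_def proper_coloring_def)
  consider u v w x where "distinct [u, v, w, x]" "e1 = {u, v}" "e2 = {v, w}" "e3 = {w, x}"
    | u v w where "e1 = {u, v}" "e2 = {v, w}" "e3 = {w, u}"
    using assms(3) unfolding consecutive_def by blast
  then show False
  proof cases
    case 1
    then have adj: "u \<rightarrow>\<^bsub>G\<^esub> v" "v \<rightarrow>\<^bsub>G\<^esub> w" "w \<rightarrow>\<^bsub>G\<^esub> x"
      using assms(3) by (auto simp: consecutive_def edges_iff_adj)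
    \<comment> \<open>Of the two ways to match the pairs, the one with \<open>c w = c v\<close>
      fails at the middle edge.\<close>
    then have c: "c w = c u" "c x = c v"
      using eq neq(1)[of v w] 1 by (auto simp: doubleton_eq_iff)
    let ?S = "color_class G c (c u) \<union> color_class G c (c v)"
    have S: "{u, v, w, x} \<subseteq> ?S"
      using adj adj_in_verts c by (auto simp: color_class_def)
    have "graph (G \<restriction> ?S)"
      by (rule graph_induce_subgraph[OF assms(1)]) (auto simp: color_class_def)
    moreover have "star_forest (G \<restriction> ?S)"
      using assms(2) neq[OF adj(1)] by (auto simp: star_coloring_def)
    moreover have "y \<rightarrow>\<^bsub>G \<restriction> ?S\<^esub> z" if "y \<rightarrow>\<^bsub>G\<^esub> z" "y \<in> ?S" "z \<in> ?S" for y z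
      using that by (force simp: arcs_ends_conv)
    ultimately have "u = w \<or> v = x"
      using adj S by (intro star_forest_no_P4[of "G \<restriction> ?S"]) auto
    with 1 show False by simp
  next
    case 2
    then have "u \<rightarrow>\<^bsub>G\<^esub> v" "v \<rightarrow>\<^bsub>G\<^esub> w"
      using assms(3) by (auto simp: consecutive_def edges_iff_adj)
    \<comment> \<open>Both pairs contain \<open>c u\<close>, so their equality would force
      \<open>c v = c w\<close> on adjacent vertices.\<close>
    then show False
      using neq(1)[of u v] neq(1)[of v w] eq 2 by (auto simp: doubleton_eq_iff)
  qed
qed

lemma injective_edge_coloring_of_star_coloring:
  assumes "graph G" "star_coloring G k c"
  shows "\<exists>d. injective_edge_coloring G (k choose 2) d"
proof -
  interpret graph G by fact
  let ?P = "{A. A \<subseteq> {1..k} \<and> card A = 2}"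
  have "finite ?P" "card ?P = k choose 2"
    using n_subsets[of "{1..k}" 2] by simp_all
  \<comment> \<open>\<open>f\<close> numbers the two-element color sets, since edge colors have to
    be natural numbers from 1 on.\<close>
  then obtain f where f: "bij_betw f ?P {1..k choose 2}"
    by (metis bij_betw_iff_card card_atLeastAtMost diff_Suc_1 finite_atLeastAtMost)
  have im: "c ` e \<in> ?P" if e: "e \<in> edges G" for e
  proof -
    obtain u v where "u \<rightarrow>\<^bsub>G\<^esub> v" "e = {u, v}"
      using e unfolding edges_def by blast
    then show ?thesis
      using assms(2) adj_in_verts[of u v]
      by (auto simp: star_coloring_def proper_coloring_def)
  qed
  have "injective_edge_coloring G (k choose 2) (\<lambda>e. f (c ` e))"
    unfolding injective_edge_coloring_def
  proof (intro conjI allI impI)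
    show "(\<lambda>e. f (c ` e)) ` edges G \<subseteq> {1..k choose 2}"
      using im f by (auto simp: bij_betw_def)
    fix e1 e2 e3 assume con: "consecutive G e1 e2 e3"
    then have "c ` e1 \<in> ?P" "c ` e3 \<in> ?P"
      using im by (auto simp only: consecutive_def)
    then show "f (c ` e1) \<noteq> f (c ` e3)"
      using star_coloring_image_neq[OF assms con] f
      by (metis (no_types, lifting) bij_betw_imp_inj_on inj_on_contraD)
  qed
  then show ?thesis by blast
qed

theorem theorem1p6:
  fixes G :: "('a, 'b) pre_digraph" and k :: nat
  assumes "graph G"
    and "star_chromatic_number G = k"
  shows "real (injective_chromatic_index G) \<le> real k * (real k - 1) / 2"
proof -
  have "\<exists>c. star_coloring G k c"
    using LeastI_ex[OF star_coloring_exists[OF assms(1)]] assms(2)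
    by (simp add: star_chromatic_number_def)
  then have "injective_chromatic_index G \<le> k choose 2"
    using injective_edge_coloring_of_star_coloring[OF assms(1)]
    unfolding injective_chromatic_index_def by (metis (mono_tags, lifting) Least_le)
  then have "real (injective_chromatic_index G) \<le> real (k choose 2)"
    by simp
  also have "\<dots> = real k * (real k - 1) / 2"
    \<comment> \<open>The case split removes the truncated subtraction \<open>k - 1\<close> coming
      from \<open>choose_two\<close>; for \<open>k = 0\<close> both sides are 0.\<close>
    by (cases k) (auto simp: choose_two real_of_nat_div algebra_simps)
  finally show ?thesis .
qed

end
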